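(* For every bivariate copula $C$ and any $1\le p_1\le p_2\le+\infty$, $$\mu_{p_1}(C)\;\le\;\mu_{p_2}(C).$$ In particular, $\mu_1(C)\le\mu_p(C)\le\mu_\infty(C)$ for all $p\in[1,+\infty]$.
   Context: A (bivariate) copula is a function $C:[0,1]^2\to[0,1]$ with $C(t,0)=C(0,t)=0$, $C(t,1)=C(1,t)=t$ for all $t\in[0,1]$, and $C(u',v')-C(u,v')-C(u',v)+C(u,v)\ge 0$ whenever $u\le u'$, $v\le v'$ in $[0,1]$. For $p\in[1,\infty)$, $\mu_p(C)=\left(\int_{[0,1]^2}|C(u,v)-C(v,u)|^p\,du\,dv\right)^{1/p}$, and $\mu_\infty(C)=\sup_{(u,v)\in[0,1]^2}|C(u,v)-C(v,u)|$. *)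

theory Defs
  imports "HOL-Analysis.Analysis"
begin

(* Copulas are total functions on the plane; only their values on the unit square are
   constrained, and only these values are used in mu below. *)
definition copula :: "(real \<Rightarrow> real \<Rightarrow> real) \<Rightarrow> bool" where
  "copula C \<longleftrightarrow>
     (\<forall>u\<in>{0..1}. \<forall>v\<in>{0..1}. C u v \<in> {0..1}) \<and>
     (\<forall>t\<in>{0..1}. C t 0 = 0 \<and> C 0 t = 0) \<and>
     (\<forall>t\<in>{0..1}. C t 1 = t \<and> C 1 t = t) \<and>
     (\<forall>u\<in>{0..1}. \<forall>u'\<in>{0..1}. \<forall>v\<in>{0..1}. \<forall>v'\<in>{0..1}.
        u \<le> u' \<longrightarrow> v \<le> v' \<longrightarrow> C u' v' - C u v' - C u' v + C u v \<ge> 0)"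

(* The exponent ranges over the extended reals so that p = \<infinity> is included; the values
   are meaningful only for 1 \<le> p. For a copula the integrand is continuous and bounded on the
   unit square, so neither the Bochner integral nor the real supremum takes a default value. *)
definition mu :: "ereal \<Rightarrow> (real \<Rightarrow> real \<Rightarrow> real) \<Rightarrow> real" where
  "mu p C =
     (if p = \<infinity> then (SUP (u, v)\<in>{0..1} \<times> {0..1}. \<bar>C u v - C v u\<bar>)
      else (LINT (u, v):{0..1} \<times> {0..1}|lborel. \<bar>C u v - C v u\<bar> powr real_of_ereal p)
             powr (1 / real_of_ereal p))"

end

theory Submission
  imports Defs
begin

text \<open>On a set of measure one the power means of a nonnegative function increase with the exponent
  and are bounded by its supremum. This applies to \<open>\<bar>C u v - C v u\<bar>\<close> on the unit square,
  where all powers are integrable because a copula is 1-Lipschitz in each argument.\<close>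

text \<open>Weighted AM-GM replaces Hoelder: with \<alpha> = p/q, Young's inequality bounds
  \<open>a powr (1 - \<alpha>) * f x powr p\<close> by
  \<open>\<alpha> * f x powr q + (1 - \<alpha>) * a\<close>. Integrated over a set of measure one
  with \<open>a powr \<alpha> = I\<close>, this becomes a \<le> \<alpha> J + (1 - \<alpha>) a, hence
  a \<le> J.\<close>

lemma set_integral_powr_mono_exponent:
  fixes f :: "'a \<Rightarrow> real" and p q :: real
  assumes S: "S \<in> sets M" "emeasure M S = 1"
    and f: "\<And>x. x \<in> S \<Longrightarrow> 0 \<le> f x"
    and pq: "0 < p" "p \<le> q"
    and ip: "set_integrable M S (\<lambda>x. f x powr p)"
    and iq: "set_integrable M S (\<lambda>x. f x powr q)"
  shows "(LINT x:S|M. f x powr p) powr (1 / p) \<le> (LINT x:S|M. f x powr q) powr (1 / q)"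
proof -
  define I where "I = (LINT x:S|M. f x powr p)"
  define J where "J = (LINT x:S|M. f x powr q)"
  define \<alpha> where "\<alpha> = p / q"
  have \<alpha>: "0 < \<alpha>" "\<alpha> \<le> 1" using pq by (auto simp: \<alpha>_def)
  have I0: "0 \<le> I"
    unfolding I_def set_lebesgue_integral_def by (simp add: integral_nonneg_AE)
  show ?thesis
  proof (cases "I = 0")
    case True
    then show ?thesis by (simp add: I_def)
  next
    case False
    \<comment> \<open>Comparing with a power of \<open>I\<close> rather than with \<open>J\<close> keeps the second base in Young's
      inequality positive without discussing whether \<open>J\<close> vanishes.\<close>
    define a where "a = I powr (1 / \<alpha>)"
    have a: "0 < a" using I0 False by (simp add: a_def)
    have Ia: "I = a powr \<alpha>" using I0 False \<alpha> by (simp add: a_def powr_powr)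
    have young: "a powr (1 - \<alpha>) * f x powr p \<le> \<alpha> * f x powr q + (1 - \<alpha>) * a" if "x \<in> S" for x
    \<comment> \<open>Young's inequality is applied to positive bases, so the zeros of
      \<open>f\<close> are treated apart; there the left side vanishes.\<close>
    proof (cases "f x = 0")
      case True
      then show ?thesis using \<alpha> a by simp
    next
      case False
      then have "0 < f x" using f[OF that] by simp
      then show ?thesis
        using Youngs_inequality_0[of \<alpha> "1 - \<alpha>" "f x powr q" a] \<alpha> a pq
        by (simp add: powr_powr \<alpha>_def mult.commute)
    qed
    have ic: "set_integrable M S (\<lambda>x. (1 - \<alpha>) * a)"
      using S by (simp add: set_integrable_def)
    have "a = a powr (1 - \<alpha>) * I"
      using a by (simp add: Ia flip: powr_add)
    also have "\<dots> = (LINT x:S|M. a powr (1 - \<alpha>) * f x powr p)"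
      by (simp add: I_def)
    also have "\<dots> \<le> (LINT x:S|M. \<alpha> * f x powr q + (1 - \<alpha>) * a)"
      using ip iq ic young by (intro set_integral_mono set_integral_add) auto
    also have "\<dots> = \<alpha> * J + (1 - \<alpha>) * a"
      using iq ic S by (simp add: J_def set_integral_const measure_def)
    finally have "\<alpha> * a \<le> \<alpha> * J" by (simp add: algebra_simps)
    then have "a \<le> J" using \<alpha> by simp
    have "I powr (1 / p) = a powr (1 / q)"
      using pq by (simp add: Ia powr_powr \<alpha>_def)
    also have "\<dots> \<le> J powr (1 / q)"
      using \<open>a \<le> J\<close> a pq by (intro powr_mono2) auto
    finally show ?thesis by (simp add: I_def J_def)
  qed
qed

lemma set_integral_powr_le_bound:
  fixes f :: "'a \<Rightarrow> real" and p B :: real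
  assumes S: "S \<in> sets M" "emeasure M S = 1"
    and f: "\<And>x. x \<in> S \<Longrightarrow> 0 \<le> f x" "\<And>x. x \<in> S \<Longrightarrow> f x \<le> B"
    and p: "0 < p"
    and ip: "set_integrable M S (\<lambda>x. f x powr p)"
  shows "(LINT x:S|M. f x powr p) powr (1 / p) \<le> B"
proof -
  \<comment> \<open>A point of \<open>S\<close> forces B \<ge> 0, without which
    \<open>(B powr p) powr (1 / p)\<close> need not collapse to \<open>B\<close>.\<close>
  have "S \<noteq> {}" using S by auto
  then have B: "0 \<le> B" using f by (meson ex_in_conv order_trans)
  have "(LINT x:S|M. f x powr p) \<le> (LINT x:S|M. B powr p)"
    using ip f p S by (intro set_integral_mono powr_mono2) (auto simp: set_integrable_def)
  also have "\<dots> = B powr p"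
    using S by (simp add: set_integral_const measure_def)
  finally have "(LINT x:S|M. f x powr p) powr (1 / p) \<le> (B powr p) powr (1 / p)"
    using p unfolding set_lebesgue_integral_def
    by (intro powr_mono2) (auto simp: integral_nonneg_AE)
  then show ?thesis using p B by (simp add: powr_powr)
qed

lemma copula_flip: "copula C \<Longrightarrow> copula (\<lambda>u v. C v u)"
  unfolding copula_def by (auto simp: algebra_simps)

text \<open>For x \<le> y the increment \<open>C y v - C x v\<close> is nondecreasing in
  \<open>v\<close> by the rectangle inequality. It equals 0 at v = 0 and y - x at v = 1, so it stays
  between these values.\<close>

lemma copula_lipschitz_left:
  assumes C: "copula C" and u: "u \<in> {0..1}" "u' \<in> {0..1}" and v: "v \<in> {0..1}"
  shows "\<bar>C u' v - C u v\<bar> \<le> \<bar>u' - u\<bar>"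
proof -
  have le: "\<bar>C y v - C x v\<bar> \<le> y - x" if xy: "x \<in> {0..1}" "y \<in> {0..1}" "x \<le> y" for x y
  proof -
    have inc: "C y w' - C x w' - C y w + C x w \<ge> 0"
      if "w \<in> {0..1}" "w' \<in> {0..1}" "w \<le> w'" for w w'
      using C xy that unfolding copula_def by blast
    have "C y v - C x v - C y 0 + C x 0 \<ge> 0" "C y 1 - C x 1 - C y v + C x v \<ge> 0"
      using inc[of 0 v] inc[of v 1] v by auto
    moreover have "C x 0 = 0" "C y 0 = 0" "C x 1 = x" "C y 1 = y"
      using C xy unfolding copula_def by auto
    ultimately show ?thesis by simp
  qed
  show ?thesis
    using le[of u u'] le[of u' u] u by (cases "u \<le> u'") auto
qed

lemma copula_continuous_on:
  assumes C: "copula C"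
  shows "continuous_on ({0..1} \<times> {0..1}) (\<lambda>(u, v). C u v)"
proof -
  have "2-lipschitz_on ({0..1} \<times> {0..1}) (\<lambda>(u, v). C u v)"
  proof (rule lipschitz_onI; clarify?)
    fix a b c d :: real
    assume h: "a \<in> {0..1}" "b \<in> {0..1}" "c \<in> {0..1}" "d \<in> {0..1}"
    \<comment> \<open>One coordinate moves at a time, through the point (c, b); the flipped copula
      handles the second. Each coordinate distance is at most the distance of the pairs, whence the
      constant 2.\<close>
    have "\<bar>C a b - C c b\<bar> \<le> dist a c" "\<bar>C c b - C c d\<bar> \<le> dist b d"
      using copula_lipschitz_left[OF C, of c a b]
        copula_lipschitz_left[OF copula_flip[OF C], of d b c] h
      by (auto simp: dist_real_def)
    then have "dist (C a b) (C c d) \<le> dist a c + dist b d"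
      by (simp add: dist_real_def)
    also have "\<dots> \<le> 2 * dist (a, b) (c, d)"
      using dist_fst_le[of "(a, b)" "(c, d)"] dist_snd_le[of "(a, b)" "(c, d)"] by simp
    finally show "dist (C a b) (C c d) \<le> 2 * dist (a, b) (c, d)" .
  qed simp
  then show ?thesis by (rule lipschitz_on_continuous_on)
qed

theorem proposition4:
  fixes C :: "real \<Rightarrow> real \<Rightarrow> real"
  assumes "copula C"
  shows "(\<forall>p1 p2 :: ereal. 1 \<le> p1 \<longrightarrow> p1 \<le> p2 \<longrightarrow> mu p1 C \<le> mu p2 C) \<and>
         (\<forall>p :: ereal. 1 \<le> p \<longrightarrow> mu 1 C \<le> mu p C \<and> mu p C \<le> mu \<infinity> C)"
proof -
  define S :: "(real \<times> real) set" where "S = {0..1} \<times> {0..1}"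
  define f where "f = (\<lambda>(u, v). \<bar>C u v - C v u\<bar>)"
  have S_cbox: "S = cbox (0, 0) (1, 1)" by (simp add: S_def cbox_Pair_eq)
  have S_sets: "S \<in> sets lborel" by (simp add: S_cbox)
  have S_one: "emeasure lborel S = 1"
    by (simp add: S_cbox emeasure_lborel_cbox_eq Basis_prod_def prod.union_disjoint)
  have S_compact: "compact S" by (simp add: S_cbox compact_cbox)
  have f_cont: "continuous_on S f"
    using copula_continuous_on[OF assms] copula_continuous_on[OF copula_flip[OF assms]]
    unfolding f_def S_def case_prod_unfold by (intro continuous_intros)
  have f_nonneg: "0 \<le> f x" for x by (simp add: f_def split: prod.split)
  have f_int: "set_integrable lborel S (\<lambda>x. f x powr r)" if "1 \<le> r" for r
  proof -
    \<comment> \<open>Since \<open>f\<close> vanishes on the diagonal, continuity of the power there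
      relies on r > 0.\<close>
    have "continuous_on S (\<lambda>x. f x powr r)"
      using f_cont f_nonneg that by (intro continuous_on_powr') auto
    then show ?thesis
      unfolding set_integrable_def by (rule borel_integrable_compact[OF S_compact])
  qed
  have f_bdd: "bdd_above (f ` S)"
    using compact_continuous_image[OF f_cont S_compact]
    by (intro bounded_imp_bdd_above compact_imp_bounded)
  have mu_inf: "mu \<infinity> C = (SUP x\<in>S. f x)"
    by (simp add: mu_def S_def f_def)
  have mu_fin: "mu (ereal r) C = (LINT x:S|lborel. f x powr r) powr (1 / r)" for r
    by (simp add: mu_def S_def f_def case_prod_unfold)
  have mono: "mu p C \<le> mu q C" if p: "1 \<le> p" and pq: "p \<le> q" for p q
  \<comment> \<open>A finite \<open>q\<close> makes \<open>p\<close> finite and compares two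
    integrals; q = \<infinity> compares an integral with the supremum, or the supremum with
    itself.\<close>
  proof (cases q)
    case (real s)
    then obtain r where r: "p = ereal r" using p pq by (cases p) auto
    show ?thesis
      using p pq unfolding real r mu_fin
      by (intro set_integral_powr_mono_exponent S_sets S_one f_int f_nonneg)
        (auto simp: one_ereal_def)
  next
    case PInf
    show ?thesis
    proof (cases p)
      case (real r)
      show ?thesis
        using p unfolding real PInf mu_fin mu_inf
        by (intro set_integral_powr_le_bound S_sets S_one f_int f_nonneg cSUP_upper f_bdd)
          (auto simp: one_ereal_def)
    qed (use p PInf in auto)
  qed (use p pq in auto)
  then show ?thesis by auto
qed

end
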